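(* Let $X$ be a Hausdorff locally convex space, let $S\subset X$ be a compact set which is star-shaped with respect to a point $p\in S$, and suppose that the convexity index $\alpha_p=\alpha_p(S)$ of $S$ with respect to $p$ satisfies $\alpha_p>0$. Then every continuous self-mapping $f:S\to S$ has one of the following two properties: (a) the point $p$ is a fixed point of $f$, i.e. $f(p)=p$; (b) $f$ has uncountably many different eigenvalues and eigenvectors; that is, there exists an injective mapping $\lambda\mapsto x_\lambda$ from $(0,1]$ into $S$ such that for every $\lambda\in(0,1]$ $$f(x_\lambda)=p+\frac{1}{\lambda\alpha_p}(x_\lambda-p).$$
   Context: A subset $S$ of a linear topological space $X$ is star-shaped with respect to $p\in S$ if for every $x\in S$ the segment $\{\lambda x+(1-\lambda)p:\lambda\in[0,1]\}$ is contained in $S$. For a set $S$ star-shaped with respect to $p$, define the extended real-valued function $$\rho_{S,p}(x)=\inf\{r>0: x-p\in r(S-p)\},\qquad x\in X,$$ with $\inf\emptyset=+\infty$. Let $C=\overline{\mathrm{co}}(S)$ be the closed convex hull of $S$ (and define $\rho_{C,p}$ by the same formula). The convexity index of $S$ with respect to $p$ is $$\alpha_p(S)=\inf_{x\in C}\frac{\rho_{C,p}(x)}{\rho_{S,p}(x)},$$ with the conventions that a quotient $0/0$ is read as $1$ and a finite number divided by $+\infty$ is $0$. (Since $S\subset C$, one has $\rho_{C,p}\le\rho_{S,p}$, and $\rho_{C,p}\le 1$ on $C$, so $\alpha_p(S)\in[0,1]$.) *)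

theory Defs
  imports "HOL-Analysis.Analysis"
begin

text \<open>A class specification cannot mention \<^const>\<open>convex\<close>, which is defined outside the
  class context, so its definition is unfolded here.\<close>

class locally_convex_space = real_vector + topological_ab_group_add +
  assumes tendsto_scaleR_nhds_Pair:
    "filterlim (\<lambda>z. fst z *\<^sub>R snd z) (nhds (r *\<^sub>R x)) (nhds r \<times>\<^sub>F nhds x)"
  assumes convex_local_base_unfolded:
    "open U \<Longrightarrow> 0 \<in> U \<Longrightarrow> \<exists>V. open V \<and> 0 \<in> V \<and>
      (\<forall>x\<in>V. \<forall>y\<in>V. \<forall>u\<ge>0. \<forall>v\<ge>0. u + v = 1 \<longrightarrow> u *\<^sub>R x + v *\<^sub>R y \<in> V) \<and> V \<subseteq> U"

lemma convex_local_base: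
  fixes U :: "'a::locally_convex_space set"
  assumes "open U" "0 \<in> U"
  shows "\<exists>V. open V \<and> 0 \<in> V \<and> convex V \<and> V \<subseteq> U"
  using convex_local_base_unfolded[OF assms] by (simp add: convex_def)

instance real_normed_vector \<subseteq> locally_convex_space
proof
  fix r :: real and x :: 'a
  have "((\<lambda>z. fst z *\<^sub>R snd z) \<longlongrightarrow> r *\<^sub>R x) (nhds (r, x))"
    using tendsto_scaleR[OF tendsto_fst[OF filterlim_ident] tendsto_snd[OF filterlim_ident],
        of "(r, x)"]
    by simp
  then show "filterlim (\<lambda>z. fst z *\<^sub>R snd z) (nhds (r *\<^sub>R x)) (nhds r \<times>\<^sub>F nhds x)"
    by (simp add: nhds_prod)
next
  fix U :: "'a set"
  assume "open U" "0 \<in> U"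
  then obtain e where "e > 0" "ball 0 e \<subseteq> U"
    by (meson open_contains_ball)
  moreover have "\<forall>x\<in>ball 0 e. \<forall>y\<in>ball 0 e. \<forall>u\<ge>0. \<forall>v\<ge>0.
      u + v = 1 \<longrightarrow> u *\<^sub>R x + v *\<^sub>R y \<in> ball (0::'a) e"
    using convex_ball[of "0::'a" e] by (simp only: convex_def)
  ultimately show "\<exists>V. open V \<and> 0 \<in> V \<and>
      (\<forall>x\<in>V. \<forall>y\<in>V. \<forall>u\<ge>0. \<forall>v\<ge>0. u + v = 1 \<longrightarrow> u *\<^sub>R x + v *\<^sub>R y \<in> V) \<and> V \<subseteq> U"
    using \<open>e > 0\<close> by (meson centre_in_ball open_ball)
qed

text \<open>The library predicate \<open>starlike\<close> does not name the centre, which matters here.\<close>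

definition star_shaped :: "'a::real_vector set \<Rightarrow> 'a \<Rightarrow> bool"
  where "star_shaped S p \<longleftrightarrow> p \<in> S \<and> (\<forall>x\<in>S. closed_segment p x \<subseteq> S)"

text \<open>In \<^typ>\<open>ereal\<close> the infimum of the empty set is \<open>\<infinity>\<close>, as required.\<close>

definition gauge_at :: "'a::real_vector set \<Rightarrow> 'a \<Rightarrow> 'a \<Rightarrow> ereal"
  where "gauge_at S p x =
    (INF r\<in>{r::real. 0 < r \<and> x - p \<in> (\<lambda>y. r *\<^sub>R (y - p)) ` S}. ereal r)"

text \<open>Division on \<^typ>\<open>ereal\<close> already gives \<open>a / \<infinity> = 0\<close> for finite \<open>a\<close>, but
  it gives \<open>0 / 0 = 0\<close>, where the value \<open>1\<close> is needed.\<close>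

definition gauge_quotient :: "ereal \<Rightarrow> ereal \<Rightarrow> ereal"
  where "gauge_quotient a b = (if a = 0 \<and> b = 0 then 1 else a / b)"

definition convexity_index ::
  "'a::{real_vector,topological_space} set \<Rightarrow> 'a \<Rightarrow> ereal"
  where "convexity_index S p =
    (let C = closure (convex hull S)
     in INF x\<in>C. gauge_quotient (gauge_at C p x) (gauge_at S p x))"

lemma gauge_at_nonneg: "0 \<le> gauge_at S p x"
  unfolding gauge_at_def by (rule INF_greatest) auto

lemma gauge_at_center:
  assumes "p \<in> S"
  shows "gauge_at S p p = 0"
proof (rule antisym)
  have "gauge_at S p p \<le> ereal e" if "0 < e" for e :: real
    unfolding gauge_at_def by (rule INF_lower) (use that assms in auto)
  then show "gauge_at S p p \<le> 0"
    by (simp add: ereal_le_epsilon2)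
qed (rule gauge_at_nonneg)

text \<open>Hence passing from \<open>convexity_index S p\<close> to its real value loses nothing.\<close>

lemma convexity_index_bounds:
  fixes S :: "'a::{real_vector,topological_space} set"
  assumes "p \<in> S"
  shows "0 \<le> convexity_index S p" "convexity_index S p \<le> 1"
proof -
  let ?C = "closure (convex hull S)"
  have p: "p \<in> ?C"
    using assms by (meson closure_subset hull_inc subsetD)
  show "0 \<le> convexity_index S p"
    unfolding convexity_index_def Let_def gauge_quotient_def
    by (rule INF_greatest)
      (auto simp: gauge_at_nonneg divide_ereal_def ereal_inverse_nonneg_iff)
  have "convexity_index S p \<le> gauge_quotient (gauge_at ?C p p) (gauge_at S p p)"
    unfolding convexity_index_def Let_def using p by (rule INF_lower)
  also have "\<dots> = 1"
    using p assms by (simp add: gauge_at_center gauge_quotient_def)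
  finally show "convexity_index S p \<le> 1" .
qed

end

theory Submission
  imports Defs
begin

text \<open>
  Put \<open>C = closure (convex hull S)\<close> and let \<open>a > 0\<close> be the convexity index of \<open>S\<close> with respect
  to \<open>p\<close>. A point of \<open>C\<close> has gauge at most \<open>1\<close> with respect to \<open>C\<close>, hence gauge at most \<open>1 / a\<close>
  with respect to \<open>S\<close>. So the copy \<open>D = p + a (C - p)\<close> of \<open>C\<close> shrunk towards \<open>p\<close> is contained in
  \<open>S\<close> (\<open>shrunken_closed_hull_subset\<close>). As a closed subset of the compact set \<open>S\<close> it is compact, and
  it is convex because \<open>C\<close> is.

  For \<open>0 < l \<le> 1\<close> the map \<open>x \<mapsto> p + l a (f x - p)\<close> sends \<open>S\<close>, and therefore \<open>D\<close>, into \<open>D\<close>: the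
  factor \<open>l\<close> keeps \<open>f x\<close> in the star-shaped set \<open>S \<subseteq> C\<close>, and the factor \<open>a\<close> moves \<open>C\<close> onto \<open>D\<close>. By
  the Schauder--Tychonoff theorem (\<open>schauder_tychonoff\<close>) it has a fixed point \<open>x\<^sub>l\<close>, and solving the
  fixed point equation for \<open>f x\<^sub>l\<close> gives the eigenvalue equation. If one point served two different
  parameters, the two eigenvalue equations would force it to be \<open>p\<close>, and then \<open>f p = p\<close>. So
  \<open>l \<mapsto> x\<^sub>l\<close> is injective unless \<open>p\<close> is fixed.

  The Schauder--Tychonoff theorem is derived from Brouwer's theorem for cubes of arbitrary finite
  dimension (\<open>brouwer_unit_cube\<close>), itself a consequence of Kuhn's combinatorial lemma. The passage
  uses Schauder projections: replacing each point of \<open>D\<close> by a continuously weighted barycentre of finitely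
  many reference points moves it only by an element of a given convex neighbourhood of \<open>0\<close>,
  and reduces a self-map of \<open>D\<close> to one of a cube (\<open>schauder_approximate_fixed_point\<close>). Compactness then turns
  approximate fixed points into an exact one.
\<close>

section \<open>Brouwer's fixed point theorem for cubes\<close>

text \<open>The dimension \<open>n\<close> has to be a number and not a type, because the Schauder projection chooses it
  inside a proof. Setting the coordinates from \<open>n\<close> on to \<open>0\<close> makes the cube compact
  in the metrizable product topology on \<^typ>\<open>nat \<Rightarrow> real\<close>.\<close>

definition unit_cube :: "nat \<Rightarrow> (nat \<Rightarrow> real) set"
  where "unit_cube n = {t. (\<forall>i. 0 \<le> t i \<and> t i \<le> 1) \<and> (\<forall>i\<ge>n. t i = 0)}"

lemma compact_unit_cube: "compact (unit_cube n)"
proof -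
  have eq: "unit_cube n = PiE UNIV (\<lambda>i. if i < n then {0..1} else {0})"
  proof (intro set_eqI iffI)
    fix t :: "nat \<Rightarrow> real"
    assume "t \<in> PiE UNIV (\<lambda>i. if i < n then {0..1} else {0})"
    then have t: "t i \<in> (if i < n then {0..1} else {0})" for i
      by blast
    have "0 \<le> t i \<and> t i \<le> 1" "n \<le> i \<longrightarrow> t i = 0" for i
      using t[of i] by (auto split: if_splits)
    then show "t \<in> unit_cube n"
      by (simp add: unit_cube_def)
  qed (auto simp: unit_cube_def)
  have "compactin (product_topology (\<lambda>_. euclidean) UNIV)
      (PiE UNIV (\<lambda>i::nat. if i < n then {0..1::real} else {0}))"
    unfolding compactin_PiE by auto
  then show ?thesis
    unfolding eq by (simp add: euclidean_product_topology)
qed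

text \<open>Label a vertex of the grid of mesh \<open>1 / Suc m\<close> in direction \<open>i\<close> by \<open>1\<close> if \<open>F\<close> moves it down in
  that direction and by \<open>0\<close> if \<open>F\<close> does not, up to a convention on the faces. Kuhn's lemma provides a small cube in which, for every
  direction, both labels occur; \<open>a\<close> and \<open>b\<close> are the vertices with label \<open>1\<close> and \<open>0\<close>.\<close>

lemma unit_cube_approximate_fixed_point:
  assumes maps: "\<And>t i. t \<in> unit_cube n \<Longrightarrow> i < n \<Longrightarrow> 0 \<le> F t i \<and> F t i \<le> 1"
  shows "\<exists>c\<in>unit_cube n. \<forall>i<n. \<exists>a\<in>unit_cube n. \<exists>b\<in>unit_cube n.
    (\<forall>j. \<bar>a j - c j\<bar> \<le> 1 / real (Suc m)) \<and> (\<forall>j. \<bar>b j - c j\<bar> \<le> 1 / real (Suc m)) \<and>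
    F a i \<le> a i \<and> b i \<le> F b i"
proof -
  define emb where
    "emb x = (\<lambda>i. if i < n then real (x i) / real (Suc m) else 0)" for x :: "nat \<Rightarrow> nat"
  \<comment> \<open>Kuhn's lemma prescribes label \<open>0\<close> on each lower face and label \<open>1\<close> on each upper face. Since
    \<open>F\<close> stays in the cube, it cannot move a point down on a lower face or up on an upper face, so
    label \<open>1\<close> still implies \<open>F (emb x) i \<le> emb x i\<close> and label \<open>0\<close> the reverse inequality.\<close>
  define label where
    "label x i = (if x i = Suc m \<or> x i \<noteq> 0 \<and> F (emb x) i < emb x i then 1 else 0 :: nat)"
    for x i
  have emb: "emb x \<in> unit_cube n" if "\<forall>i<n. x i \<le> Suc m" for x
    using that by (auto simp: emb_def unit_cube_def divide_le_eq_1 simp flip: of_nat_Suc)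
  obtain q where q: "\<forall>i<n. q i < Suc m"
    and rs: "\<forall>i<n. \<exists>r s. (\<forall>j<n. q j \<le> r j \<and> r j \<le> q j + 1) \<and>
      (\<forall>j<n. q j \<le> s j \<and> s j \<le> q j + 1) \<and> label r i \<noteq> label s i"
    by (rule kuhn_lemma[of "Suc m" n label]) (auto simp: label_def)
  show ?thesis
  proof (rule bexI[of _ "emb q"], intro allI impI)
    show "emb q \<in> unit_cube n"
      using q by (intro emb) auto
    fix i
    assume i: "i < n"
    from rs i obtain r0 s0 where rs0: "\<forall>j<n. q j \<le> r0 j \<and> r0 j \<le> q j + 1"
      "\<forall>j<n. q j \<le> s0 j \<and> s0 j \<le> q j + 1" "label r0 i \<noteq> label s0 i"
      by blast
    have "label r0 i = 1 \<and> label s0 i = 0 \<or> label r0 i = 0 \<and> label s0 i = 1"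
      using rs0(3) by (auto simp: label_def split: if_splits)
    then obtain r s where r: "\<forall>j<n. q j \<le> r j \<and> r j \<le> q j + 1" "label r i = 1"
      and s: "\<forall>j<n. q j \<le> s j \<and> s j \<le> q j + 1" "label s i = 0"
      using rs0 by metis
    have near: "\<bar>emb x j - emb q j\<bar> \<le> 1 / real (Suc m)"
      if "\<forall>j<n. q j \<le> x j \<and> x j \<le> q j + 1" for x j
    proof (cases "j < n")
      case True
      then have "\<bar>real (x j) - real (q j)\<bar> \<le> 1"
        using that by force
      then have "\<bar>real (x j) - real (q j)\<bar> / real (Suc m) \<le> 1 / real (Suc m)"
        by (rule divide_right_mono) simp
      then show ?thesis
        using True by (simp add: emb_def abs_divide flip: diff_divide_distrib of_nat_Suc)
    qed (simp add: emb_def)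
    have cube: "emb x \<in> unit_cube n" if "\<forall>j<n. q j \<le> x j \<and> x j \<le> q j + 1" for x
    proof (intro emb allI impI)
      fix j
      assume "j < n"
      then show "x j \<le> Suc m"
        using that q by fastforce
    qed
    have "F (emb r) i \<le> emb r i"
    proof (cases "r i = Suc m")
      case True
      then have "emb r i = 1"
        using i by (simp add: emb_def)
      then show ?thesis
        using maps[OF cube[OF r(1)] i] by simp
    next
      case False
      then show ?thesis
        using r(2) by (auto simp: label_def split: if_splits)
    qed
    moreover have "emb s i \<le> F (emb s) i"
    proof (cases "s i = 0")
      case True
      then have "emb s i = 0"
        by (simp add: emb_def)
      then show ?thesis
        using maps[OF cube[OF s(1)] i] by simp
    next
      case False
      then show ?thesis
        using s(2) by (auto simp: label_def split: if_splits)
    qed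
    ultimately show "\<exists>a\<in>unit_cube n. \<exists>b\<in>unit_cube n.
        (\<forall>j. \<bar>a j - emb q j\<bar> \<le> 1 / real (Suc m)) \<and>
        (\<forall>j. \<bar>b j - emb q j\<bar> \<le> 1 / real (Suc m)) \<and> F a i \<le> a i \<and> b i \<le> F b i"
      using cube near r(1) s(1) by blast
  qed
qed

text \<open>The small cubes at mesh \<open>1 / Suc m\<close> have a cluster point \<open>t\<close>. In each direction both kinds of
  vertices converge to \<open>t\<close> along the subsequence, so continuity gives \<open>F t i \<le> t i\<close> and
  \<open>t i \<le> F t i\<close>.\<close>

theorem brouwer_unit_cube:
  assumes cont: "\<And>i. i < n \<Longrightarrow> continuous_on (unit_cube n) (\<lambda>t. F t i)"
    and maps: "\<And>t i. t \<in> unit_cube n \<Longrightarrow> i < n \<Longrightarrow> 0 \<le> F t i \<and> F t i \<le> 1"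
  obtains t where "t \<in> unit_cube n" "\<And>i. i < n \<Longrightarrow> F t i = t i"
proof -
  obtain c where c: "\<And>m. c m \<in> unit_cube n" and
    ab: "\<And>m i. i < n \<Longrightarrow> \<exists>a\<in>unit_cube n. \<exists>b\<in>unit_cube n.
      (\<forall>j. \<bar>a j - c m j\<bar> \<le> 1 / real (Suc m)) \<and> (\<forall>j. \<bar>b j - c m j\<bar> \<le> 1 / real (Suc m)) \<and>
      F a i \<le> a i \<and> b i \<le> F b i"
    using unit_cube_approximate_fixed_point[of n F, OF maps] by metis
  obtain t \<sigma> where t: "t \<in> unit_cube n" and \<sigma>: "strict_mono (\<sigma> :: nat \<Rightarrow> nat)"
    and lim: "(c \<circ> \<sigma>) \<longlonglongrightarrow> t"
    using compact_imp_seq_compact[OF compact_unit_cube[of n]] c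
    unfolding seq_compact_def by metis
  have lim_c: "(\<lambda>k. c (\<sigma> k) j) \<longlonglongrightarrow> t j" for j
    using continuous_on_tendsto_compose[OF
        continuous_on_product_then_coordinatewise[OF continuous_on_id, of UNIV j] lim]
    by simp
  have null: "(\<lambda>k. 1 / real (Suc (\<sigma> k))) \<longlonglongrightarrow> 0"
    using LIMSEQ_subseq_LIMSEQ[OF LIMSEQ_inverse_real_of_nat \<sigma>]
    by (simp add: o_def inverse_eq_divide)
  have lim_near: "x \<longlonglongrightarrow> t"
    if "\<And>k j. \<bar>x k j - c (\<sigma> k) j\<bar> \<le> 1 / real (Suc (\<sigma> k))" for x
  proof -
    have "(\<lambda>k. x k j) \<longlonglongrightarrow> t j" for j
    proof -
      have "(\<lambda>k. x k j - c (\<sigma> k) j) \<longlonglongrightarrow> 0"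
        by (rule Lim_null_comparison[OF _ null]) (use that in simp)
      from tendsto_add[OF this lim_c[of j]] show ?thesis
        by simp
    qed
    then have "limitin (product_topology (\<lambda>_. euclidean) UNIV) x t sequentially"
      by (simp add: limitin_componentwise)
    then show ?thesis
      by (simp add: euclidean_product_topology)
  qed
  have "F t i = t i" if i: "i < n" for i
  proof (rule antisym)
    obtain a b where a: "\<And>m. a m \<in> unit_cube n" "\<And>m j. \<bar>a m j - c m j\<bar> \<le> 1 / real (Suc m)"
        "\<And>m. F (a m) i \<le> a m i"
      and b: "\<And>m. b m \<in> unit_cube n" "\<And>m j. \<bar>b m j - c m j\<bar> \<le> 1 / real (Suc m)"
        "\<And>m. b m i \<le> F (b m) i"
      using ab[OF i] by metis
    have lims: "(\<lambda>k. x (\<sigma> k) i) \<longlonglongrightarrow> t i" "(\<lambda>k. F (x (\<sigma> k)) i) \<longlonglongrightarrow> F t i"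
      if x: "\<And>m. x m \<in> unit_cube n" "\<And>m j. \<bar>x m j - c m j\<bar> \<le> 1 / real (Suc m)" for x
    proof -
      have l: "(\<lambda>k. x (\<sigma> k)) \<longlonglongrightarrow> t"
        by (rule lim_near) (rule x(2))
      show "(\<lambda>k. x (\<sigma> k) i) \<longlonglongrightarrow> t i"
        using continuous_on_tendsto_compose[OF
            continuous_on_product_then_coordinatewise[OF continuous_on_id, of UNIV i] l]
        by simp
      show "(\<lambda>k. F (x (\<sigma> k)) i) \<longlonglongrightarrow> F t i"
        by (rule continuous_on_tendsto_compose[OF cont[OF i] l t]) (simp add: x(1))
    qed
    show "F t i \<le> t i"
      using lims[of a, OF a(1,2)] a(3) by (intro LIMSEQ_le) auto
    show "t i \<le> F t i"
      using lims[of b, OF b(1,2)] b(3) by (intro LIMSEQ_le) auto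
  qed
  then show thesis
    using t that by blast
qed

section \<open>The Schauder--Tychonoff fixed point theorem\<close>

lemma continuous_on_scaleR_locally_convex:
  fixes g :: "'b::topological_space \<Rightarrow> 'a::locally_convex_space"
  assumes "continuous_on A c" "continuous_on A g"
  shows "continuous_on A (\<lambda>x. c x *\<^sub>R g x)"
  unfolding continuous_on_def
proof
  fix x
  assume "x \<in> A"
  then have "filterlim (\<lambda>z. (c z, g z)) (nhds (c x) \<times>\<^sub>F nhds (g x)) (at x within A)"
    using assms by (intro filterlim_Pair) (auto simp: continuous_on_def)
  from filterlim_compose[OF tendsto_scaleR_nhds_Pair this]
  show "((\<lambda>x. c x *\<^sub>R g x) \<longlongrightarrow> c x *\<^sub>R g x) (at x within A)"
    by simp
qed

lemma convex_closure_locally_convex: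
  fixes K :: "'a::locally_convex_space set"
  assumes "convex K"
  shows "convex (closure K)"
proof (rule convexI)
  fix x y and u v :: real
  assume xy: "x \<in> closure K" "y \<in> closure K" and uv: "0 \<le> u" "0 \<le> v" "u + v = 1"
  let ?h = "\<lambda>z :: 'a \<times> 'a. u *\<^sub>R fst z + v *\<^sub>R snd z"
  have "continuous_on (closure (K \<times> K)) ?h"
    by (intro continuous_on_add continuous_on_scaleR_locally_convex continuous_intros)
  moreover have "?h ` (K \<times> K) \<subseteq> closure K"
    using convexD[OF assms _ _ uv] closure_subset by fastforce
  ultimately have "?h ` closure (K \<times> K) \<subseteq> closure K"
    by (rule image_closure_subset[OF _ closed_closure])
  then show "u *\<^sub>R x + v *\<^sub>R y \<in> closure K"
    using xy by (fastforce simp: closure_Times)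
qed

text \<open>A compact Hausdorff space is normal, so Urysohn's lemma supplies weights supported near a
  given point.\<close>

lemma compact_bump_function:
  fixes D :: "'a::{topological_ab_group_add, t2_space} set"
  assumes D: "compact D" and y: "y \<in> D" and V: "open V" "0 \<in> V"
  obtains w :: "'a \<Rightarrow> real" where "continuous_on D w" "w y = 1" "\<And>x. x \<in> D \<Longrightarrow> 0 \<le> w x"
    "\<And>x. x \<in> D \<Longrightarrow> 0 < w x \<Longrightarrow> y - x \<in> V"
proof -
  let ?T = "D \<inter> (\<lambda>x. y - x) -` (- V)"
  have "Hausdorff_space (euclidean :: 'a topology)"
    using separation_t2 by (auto simp: Hausdorff_space_def disjnt_def)
  then have "compact_space (top_of_set D)" "Hausdorff_space (top_of_set D)"
    using D by (simp_all add: compact_space_subtopology Hausdorff_space_subtopology)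
  then have "normal_space (top_of_set D)"
    using compact_Hausdorff_or_regular_imp_normal_space by blast
  moreover have "closedin (top_of_set D) ?T"
    by (rule continuous_closedin_preimage) (auto intro!: continuous_intros simp: V)
  moreover have "closedin (top_of_set D) {y}"
    using y by (metis Int_empty_right Int_insert_right_if1 closedin_closed_Int closed_singleton)
  moreover have "disjnt ?T {y}"
    using V by (simp add: disjnt_def)
  ultimately obtain w where w: "continuous_map (top_of_set D) (top_of_set {0..1::real}) w"
      "w ` ?T \<subseteq> {0}" "w ` {y} \<subseteq> {1}"
    using Urysohn_lemma[of "top_of_set D" ?T "{y}" 0 1] by (metis zero_le_one)
  have "continuous_on D w" "w ` D \<subseteq> {0..1}"
    using w(1) by (auto simp: continuous_map_in_subtopology)
  moreover have "y - x \<in> V" if "x \<in> D" "0 < w x" for x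
    using that w(2) by (force simp: image_subset_iff)
  ultimately show thesis
    using w(3) by (intro that[of w]) auto
qed

text \<open>By compactness finitely many bump functions \<open>w (y i)\<close> have a positive sum on \<open>D\<close>. Dividing
  by the sum gives, for each \<open>z \<in> D\<close>, convex weights on points \<open>y i\<close> with \<open>y i - z \<in> V\<close>, whose
  barycentre differs from \<open>z\<close> by an element of the convex set \<open>V\<close>. A point that equals the
  barycentre formed for its image under \<open>g\<close> is what is sought; in terms of the weights this is a
  fixed point problem on a cube.\<close>

lemma schauder_approximate_fixed_point:
  fixes D :: "'a::{locally_convex_space, t2_space} set"
  assumes D: "compact D" "convex D" "D \<noteq> {}"
    and g: "continuous_on D g" "g ` D \<subseteq> D"
    and V: "open V" "convex V" "0 \<in> V"
  shows "\<exists>x\<in>D. x - g x \<in> V"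
proof -
  have "\<forall>y\<in>D. \<exists>w :: 'a \<Rightarrow> real. continuous_on D w \<and> w y = 1 \<and> (\<forall>x\<in>D. 0 \<le> w x) \<and>
      (\<forall>x\<in>D. 0 < w x \<longrightarrow> y - x \<in> V)"
    using compact_bump_function[OF D(1) _ V(1,3)] by metis
  then obtain w :: "'a \<Rightarrow> 'a \<Rightarrow> real" where w_cont: "\<And>y. y \<in> D \<Longrightarrow> continuous_on D (w y)"
    and w_centre: "\<And>y. y \<in> D \<Longrightarrow> w y y = 1"
    and w_nonneg: "\<And>x y. y \<in> D \<Longrightarrow> x \<in> D \<Longrightarrow> 0 \<le> w y x"
    and w_near: "\<And>x y. y \<in> D \<Longrightarrow> x \<in> D \<Longrightarrow> 0 < w y x \<Longrightarrow> y - x \<in> V"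
    by (auto dest!: bchoice)
  let ?U = "\<lambda>y. D \<inter> w y -` {0<..}"
  have "openin (top_of_set D) (?U y)" if "y \<in> D" for y
    using w_cont[OF that] by (rule continuous_openin_preimage_gen) simp
  then have "\<forall>u\<in>?U ` D. openin (top_of_set D) u"
    by blast
  moreover have "D \<subseteq> \<Union> (?U ` D)"
    using w_centre by fastforce
  ultimately obtain \<C> where \<C>: "\<C> \<subseteq> ?U ` D" "finite \<C>" "D \<subseteq> \<Union> \<C>"
    using D(1) unfolding compact_eq_openin_cover by meson
  then obtain Y where Y: "Y \<subseteq> D" "finite Y" "\<C> = ?U ` Y"
    by (meson finite_subset_image)
  obtain n and y :: "nat \<Rightarrow> 'a" where y: "Y = y ` {i. i < n}"
    using finite_imp_nat_seg_image_inj_on[OF Y(2)] by metis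
  have yD: "y i \<in> D" if "i < n" for i
    using that y Y(1) by blast
  define W where "W x = (\<Sum>i<n. w (y i) x)" for x
  have W_pos: "0 < W x" if "x \<in> D" for x
  proof -
    have "x \<in> \<Union> \<C>"
      using that \<C>(3) by blast
    then obtain i where "i < n" "0 < w (y i) x"
      by (auto simp: Y(3) y)
    then show ?thesis
      unfolding W_def using that w_nonneg yD by (intro sum_pos2[of _ i]) auto
  qed
  \<comment> \<open>The map \<open>\<pi>\<close> below extends the barycentre from the simplex to the whole cube while
    keeping its values in \<open>D\<close>: weights of sum above \<open>1\<close> are normalized, and
    mass missing from \<open>1\<close> is placed at \<open>y0\<close>.\<close>
  obtain y0 where y0: "y0 \<in> D"
    using D(3) by blast
  define m where "m t = max 1 (\<Sum>i<n. t i)" for t :: "nat \<Rightarrow> real"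
  define \<pi> where "\<pi> t = (\<Sum>i<n. (t i / m t) *\<^sub>R y i) + (1 - (\<Sum>i<n. t i / m t)) *\<^sub>R y0" for t
  have m: "1 \<le> m t" "(\<Sum>i<n. t i) \<le> m t" for t
    by (simp_all add: m_def)
  have coord: "continuous_on A (\<lambda>t :: nat \<Rightarrow> real. t i)" for A i
    by (rule continuous_on_product_then_coordinatewise) (rule continuous_on_id)
  have m0: "m t \<noteq> 0" for t
    using m(1)[of t] by linarith
  have m_cont: "continuous_on A m" for A
    unfolding m_def by (intro continuous_intros coord)
  have \<pi>_cont: "continuous_on A \<pi>" for A
    unfolding \<pi>_def
    by (intro continuous_on_add continuous_on_sum continuous_on_scaleR_locally_convex
        continuous_on_divide continuous_on_diff continuous_on_const coord m_cont) (use m0 in auto)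
  have \<pi>_D: "\<pi> t \<in> D" if "t \<in> unit_cube n" for t
  proof -
    \<comment> \<open>The mass at \<open>y0\<close> is treated as an additional summand with index \<open>n\<close>.\<close>
    let ?a = "\<lambda>i. if i < n then t i / m t else 1 - (\<Sum>i<n. t i / m t)"
    let ?z = "\<lambda>i. if i < n then y i else y0"
    have t: "0 \<le> t i" for i
      using that by (simp add: unit_cube_def)
    have "(\<Sum>i<n. t i / m t) \<le> 1"
      using m(1)[of t] m(2)[of t] by (simp add: divide_le_eq_1 flip: sum_divide_distrib)
    then have "(\<Sum>i<Suc n. ?a i *\<^sub>R ?z i) \<in> D"
      using m(1)[of t] t yD y0 by (intro convex_sum[OF _ D(2)]) auto
    also have "(\<Sum>i<Suc n. ?a i *\<^sub>R ?z i) = \<pi> t"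
      by (simp add: \<pi>_def)
    finally show ?thesis .
  qed
  have g\<pi>_D: "g (\<pi> t) \<in> D" if "t \<in> unit_cube n" for t
    using \<pi>_D[OF that] g(2) by blast
  define F where "F t i = w (y i) (g (\<pi> t)) / W (g (\<pi> t))" for t i
  have g\<pi>_cont: "continuous_on (unit_cube n) (\<lambda>t. g (\<pi> t))"
    by (rule continuous_on_compose2[OF g(1) \<pi>_cont]) (use \<pi>_D in blast)
  have w_g\<pi>_cont: "continuous_on (unit_cube n) (\<lambda>t. w (y i) (g (\<pi> t)))" if "i < n" for i
    by (rule continuous_on_compose2[OF w_cont[OF yD[OF that]] g\<pi>_cont]) (use g\<pi>_D in blast)
  obtain t where t: "t \<in> unit_cube n" and fixed: "\<And>i. i < n \<Longrightarrow> F t i = t i"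
  proof (rule brouwer_unit_cube[of n F])
    show "continuous_on (unit_cube n) (\<lambda>t. F t i)" if "i < n" for i
      unfolding F_def W_def
      by (intro continuous_on_divide continuous_on_sum w_g\<pi>_cont that)
        (use W_pos[OF g\<pi>_D] in \<open>auto simp: W_def less_imp_neq[symmetric]\<close>)
    show "0 \<le> F t i \<and> F t i \<le> 1" if "t \<in> unit_cube n" "i < n" for t i
    proof -
      have "w (y i) (g (\<pi> t)) \<le> W (g (\<pi> t))"
        unfolding W_def by (rule member_le_sum) (use that w_nonneg yD g\<pi>_D in auto)
      then show ?thesis
        using that W_pos[OF g\<pi>_D] w_nonneg[OF yD g\<pi>_D] by (simp add: F_def less_imp_le)
    qed
  qed blast
  let ?x = "\<pi> t"
  \<comment> \<open>The values of \<open>F\<close> have coordinate sum \<open>1\<close>, so its fixed point lies in the simplex, where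
    \<open>\<pi>\<close> is the plain barycentre.\<close>
  have sum_t: "(\<Sum>i<n. t i) = 1"
  proof -
    have "(\<Sum>i<n. t i) = (\<Sum>i<n. F t i)"
      using fixed by simp
    also have "\<dots> = W (g ?x) / W (g ?x)"
      by (simp add: F_def W_def flip: sum_divide_distrib)
    finally show ?thesis
      using W_pos[OF g\<pi>_D[OF t]] by simp
  qed
  then have "m t = 1"
    by (simp add: m_def)
  then have "?x - g ?x = (\<Sum>i<n. t i *\<^sub>R y i) - (\<Sum>i<n. t i) *\<^sub>R g ?x"
    by (simp add: \<pi>_def sum_t)
  also have "\<dots> = (\<Sum>i<n. t i *\<^sub>R (y i - g ?x))"
    by (simp add: scaleR_diff_right sum_subtractf scaleR_sum_left)
  also have "\<dots> = (\<Sum>i | i < n \<and> 0 < t i. t i *\<^sub>R (y i - g ?x))"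
    using t by (intro sum.mono_neutral_right) (auto simp: unit_cube_def order.order_iff_strict)
  also have "\<dots> \<in> V"
  proof (rule convex_sum[OF _ V(2)])
    have "(\<Sum>i | i < n \<and> 0 < t i. t i) = (\<Sum>i<n. t i)"
      using t by (intro sum.mono_neutral_left) (auto simp: unit_cube_def order.order_iff_strict)
    then show "(\<Sum>i | i < n \<and> 0 < t i. t i) = 1"
      using sum_t by simp
    fix i
    assume i: "i \<in> {i. i < n \<and> 0 < t i}"
    then have "0 < F t i"
      using fixed by simp
    then have "0 < w (y i) (g ?x)"
      using W_pos[OF g\<pi>_D[OF t]] by (simp add: F_def zero_less_divide_iff)
    then show "y i - g ?x \<in> V"
      using i w_near yD g\<pi>_D[OF t] by blast
  qed auto
  finally show ?thesis
    using \<pi>_D[OF t] by blast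
qed

text \<open>Without a fixed point, the compact set of all \<open>x - g x\<close> is closed and misses \<open>0\<close>, hence misses
  a convex neighbourhood of \<open>0\<close>, contrary to the existence of approximate fixed points.\<close>

theorem schauder_tychonoff:
  fixes D :: "'a::{locally_convex_space, t2_space} set"
  assumes D: "compact D" "convex D" "D \<noteq> {}"
    and g: "continuous_on D g" "g ` D \<subseteq> D"
  obtains x where "x \<in> D" "g x = x"
proof (rule ccontr)
  assume "\<not> thesis"
  then have no_fixed: "g x \<noteq> x" if "x \<in> D" for x
    using that \<open>\<And>x. x \<in> D \<Longrightarrow> g x = x \<Longrightarrow> thesis\<close> by blast
  let ?H = "(\<lambda>x. x - g x) ` D"
  have "compact ?H"
    by (intro compact_continuous_image continuous_intros g D)
  then have "open (- ?H)"
    by (simp add: compact_imp_closed open_Compl)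
  moreover have "0 \<in> - ?H"
    using no_fixed by force
  ultimately obtain V where "open V" "0 \<in> V" "convex V" "V \<subseteq> - ?H"
    using convex_local_base by blast
  with schauder_approximate_fixed_point[OF D g] show False
    by blast
qed

section \<open>The convexity index and eigenvectors\<close>

lemma le_inverse_if_gauge_quotient_ge:
  assumes u: "0 \<le> u" "u \<le> 1" and v: "0 \<le> v"
    and a: "0 < a" "ereal a \<le> gauge_quotient u v"
  shows "v \<le> ereal (1 / a)"
proof -
  obtain c where c: "u = ereal c" "0 \<le> c" "c \<le> 1"
    using u by (cases u) (auto simp: one_ereal_def)
  have "v \<noteq> \<infinity>"
    using a c by (auto simp: gauge_quotient_def zero_ereal_def)
  then obtain d where d: "v = ereal d" "0 \<le> d"
    using v by (cases v) auto
  show ?thesis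
  proof (cases "d = 0")
    case False
    then have "a \<le> c / d"
      using a(2) c d by (simp add: gauge_quotient_def zero_ereal_def)
    also have "\<dots> \<le> 1 / d"
      using c d by (intro divide_right_mono) auto
    finally show ?thesis
      using a(1) d False by (simp add: field_simps)
  qed (use a(1) d in simp)
qed

text \<open>The gauge of \<open>y\<close> with respect to \<open>S\<close> is at most \<open>1 / a\<close>. An infimum is only
  approximated by admissible scalings, so star-shapedness first puts the points with factor
  \<open>a / (1 + e)\<close> into \<open>S\<close>, for every \<open>e > 0\<close>; closedness of \<open>S\<close> then allows \<open>e\<close> to tend to \<open>0\<close>.\<close>

lemma shrunken_closed_hull_subset:
  fixes S :: "'a::locally_convex_space set"
  assumes S: "closed S" "star_shaped S p"
    and a: "0 < a" "ereal a \<le> convexity_index S p"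
    and y: "y \<in> closure (convex hull S)"
  shows "p + a *\<^sub>R (y - p) \<in> S"
proof -
  let ?C = "closure (convex hull S)"
  have gC: "gauge_at ?C p y \<le> 1"
    unfolding gauge_at_def using y by (intro INF_lower2[of 1]) (auto simp: one_ereal_def)
  have quot: "ereal a \<le> gauge_quotient (gauge_at ?C p y) (gauge_at S p y)"
    using a(2) y unfolding convexity_index_def Let_def by (meson INF_lower order_trans)
  have gS: "gauge_at S p y \<le> ereal (1 / a)"
    using le_inverse_if_gauge_quotient_ge[OF gauge_at_nonneg gC gauge_at_nonneg a(1) quot] .
  have shrink: "p + (a / (1 + e)) *\<^sub>R (y - p) \<in> S" if e: "0 < e" for e :: real
  proof -
    have "gauge_at S p y < ereal ((1 + e) / a)"
      by (rule le_less_trans[OF gS]) (use a(1) e in \<open>simp add: field_simps\<close>)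
    then obtain r s where r: "0 < r" "r < (1 + e) / a" and s: "s \<in> S" "y - p = r *\<^sub>R (s - p)"
      unfolding gauge_at_def INF_less_iff by auto
    let ?k = "a / (1 + e) * r"
    have "0 \<le> ?k" "?k \<le> 1"
      using r a(1) e by (auto simp: field_simps)
    then have "p + ?k *\<^sub>R (s - p) \<in> closed_segment p s"
      unfolding closed_segment_def by (auto intro!: exI[of _ ?k] simp: algebra_simps)
    then show ?thesis
      using S(2) s by (auto simp: star_shaped_def)
  qed
  have "continuous_on {0..} (\<lambda>e. p + (a / (1 + e)) *\<^sub>R (y - p))"
    by (intro continuous_on_add continuous_on_scaleR_locally_convex continuous_on_const
        continuous_on_divide continuous_on_id) auto
  then have "((\<lambda>e. p + (a / (1 + e)) *\<^sub>R (y - p)) \<longlongrightarrow> p + (a / (1 + 0)) *\<^sub>R (y - p))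
      (at 0 within {0..})"
    unfolding continuous_on_def by force
  then have "((\<lambda>e. p + (a / (1 + e)) *\<^sub>R (y - p)) \<longlongrightarrow> p + (a / (1 + 0)) *\<^sub>R (y - p))
      (at_right 0)"
    by (rule tendsto_within_subset) auto
  then have "((\<lambda>e. p + (a / (1 + e)) *\<^sub>R (y - p)) \<longlongrightarrow> p + a *\<^sub>R (y - p)) (at_right 0)"
    by simp
  then show ?thesis
    by (rule Lim_in_closed_set[OF S(1), rotated 2])
      (use shrink in \<open>auto simp: eventually_at_right_less eventually_at_filter\<close>)
qed

theorem theorem3p1:
  fixes S :: "'a::{locally_convex_space, t2_space} set"
    and p :: 'a
    and f :: "'a \<Rightarrow> 'a"
  assumes "compact S"
    and "star_shaped S p"
    and "convexity_index S p > 0"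
    and "continuous_on S f"
    and "f ` S \<subseteq> S"
  shows "f p = p \<or>
    (\<exists>x :: real \<Rightarrow> 'a. inj_on x {0<..1} \<and> x ` {0<..1} \<subseteq> S \<and>
      (\<forall>l\<in>{0<..1}.
        f (x l) = p + (1 / (l * real_of_ereal (convexity_index S p))) *\<^sub>R (x l - p)))"
proof (cases "f p = p")
  case False
  have pS: "p \<in> S"
    using assms(2) by (simp add: star_shaped_def)
  define a where "a = real_of_ereal (convexity_index S p)"
  have a_index: "ereal a = convexity_index S p"
    unfolding a_def using convexity_index_bounds[OF pS]
    by (cases "convexity_index S p") (auto simp: one_ereal_def)
  have a: "0 < a"
    using assms(3) by (simp flip: a_index)
  let ?C = "closure (convex hull S)"
  have SC: "S \<subseteq> ?C"
    by (meson closure_subset hull_subset order_trans)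
  have C: "convex ?C"
    by (intro convex_closure_locally_convex convex_convex_hull)
  define D where "D = (\<lambda>y. p + a *\<^sub>R (y - p)) ` ?C"
  have DS: "D \<subseteq> S"
    unfolding D_def
    using shrunken_closed_hull_subset[OF compact_imp_closed[OF assms(1)] assms(2) a] a_index by auto
  \<comment> \<open>Writing \<open>D\<close> as a preimage of \<open>C\<close> under the inverse homothety shows that it is closed.\<close>
  have "D = (\<lambda>x. p + (1 / a) *\<^sub>R (x - p)) -` ?C"
  proof (intro set_eqI iffI)
    fix x
    assume x: "x \<in> (\<lambda>x. p + (1 / a) *\<^sub>R (x - p)) -` ?C"
    show "x \<in> D"
      unfolding D_def by (rule image_eqI[of _ _ "p + (1 / a) *\<^sub>R (x - p)"]) (use a x in auto)
  qed (use a in \<open>auto simp: D_def\<close>)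
  moreover have "closed ((\<lambda>x. p + (1 / a) *\<^sub>R (x - p)) -` ?C)"
    by (intro closed_vimage closed_closure continuous_on_add continuous_on_scaleR_locally_convex
        continuous_intros)
  ultimately have "compact D"
    using DS compact_Int_closed[OF assms(1), of D] by (simp add: Int_absorb1)
  moreover have "convex D"
  proof -
    have "D = (\<lambda>z. (p - a *\<^sub>R p) + z) ` (\<lambda>y. a *\<^sub>R y) ` ?C"
      by (simp add: D_def image_image scaleR_diff_right diff_add_eq add_diff_eq)
    then show ?thesis
      using convex_translation[OF convex_scaling[OF C]] by metis
  qed
  moreover have "D \<noteq> {}"
    using SC pS by (auto simp: D_def)
  ultimately have schauder: "\<exists>x\<in>D. g x = x" if "continuous_on D g" "g ` D \<subseteq> D" for g
    using schauder_tychonoff[of D g] that by blast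
  have "\<forall>l\<in>{0<..1}. \<exists>x. x \<in> S \<and> x = p + (l * a) *\<^sub>R (f x - p)"
  proof
    fix l :: real
    assume l: "l \<in> {0<..1}"
    let ?g = "\<lambda>x. p + (l * a) *\<^sub>R (f x - p)"
    have "continuous_on D ?g"
      using assms(4) DS by (intro continuous_on_add continuous_on_scaleR_locally_convex
          continuous_on_diff continuous_on_const) (rule continuous_on_subset)
    moreover have "?g x \<in> D" if "x \<in> D" for x
    proof -
      have "f x \<in> S"
        using that DS assms(5) by blast
      moreover have "p + l *\<^sub>R (f x - p) \<in> closed_segment p (f x)"
        unfolding closed_segment_def using l by (auto intro!: exI[of _ l] simp: algebra_simps)
      ultimately have "p + l *\<^sub>R (f x - p) \<in> ?C"
        using assms(2) SC by (auto simp: star_shaped_def)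
      then show ?thesis
        unfolding D_def by (rule image_eqI[rotated]) (simp add: mult.commute)
    qed
    ultimately obtain x where "x \<in> D" "?g x = x"
      using schauder[of ?g] by blast
    then show "\<exists>x. x \<in> S \<and> x = p + (l * a) *\<^sub>R (f x - p)"
      using DS by (intro exI[of _ x] conjI) (rule subsetD, assumption+, rule sym)
  qed
  from bchoice[OF this] obtain x where x: "\<And>l. l \<in> {0<..1} \<Longrightarrow> x l \<in> S"
    and fix_x: "\<And>l. l \<in> {0<..1} \<Longrightarrow> x l = p + (l * a) *\<^sub>R (f (x l) - p)"
    by blast
  have eigen: "f (x l) = p + (1 / (l * a)) *\<^sub>R (x l - p)" if "l \<in> {0<..1}" for l
  proof -
    have "x l - p = (l * a) *\<^sub>R (f (x l) - p)"
      using arg_cong[OF fix_x[OF that], of "\<lambda>z. z - p"] by (simp only: add_diff_cancel_left')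
    then show ?thesis
      by (rule ssubst) (use that a in simp)
  qed
  moreover have "inj_on x {0<..1}"
  proof (rule inj_onI, rule ccontr)
    fix l k
    assume lk: "l \<in> {0<..1}" "k \<in> {0<..1}" "x l = x k" "l \<noteq> k"
    have "p + (1 / (l * a)) *\<^sub>R (x l - p) = p + (1 / (k * a)) *\<^sub>R (x l - p)"
      using eigen[OF lk(1)] eigen[OF lk(2)] unfolding lk(3) by (rule trans[OF sym])
    then have "(1 / (l * a)) *\<^sub>R (x l - p) = (1 / (k * a)) *\<^sub>R (x l - p)"
      by (simp only: add_left_cancel)
    moreover have "1 / (l * a) \<noteq> 1 / (k * a)"
      using lk a by (auto simp: field_simps)
    ultimately have "x l - p = 0"
      by (simp only: scaleR_cancel_right) simp
    then have "x l = p"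
      by simp
    with eigen[OF lk(1)] False show False
      by simp
  qed
  ultimately show ?thesis
    using x unfolding a_def by blast
qed simp

end
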